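(* Let $X$ be a non-empty locally compact metrizable topological space with a fixed compatible metric $d$, let $\mathcal F=\{f_1,\dots,f_m\}$ be an iterated function system on $X$, and let $H_{\mathcal F}:\mathcal K(X)\to\mathcal K(X)$ be its Hutchinson map. Then $\mathcal F$ has compact dynamics if and only if $H_{\mathcal F}$ has compact dynamics. Moreover, when these conditions hold, if $\mathcal G_{\mathcal F}\subset X$ is the global attractor of $\mathcal F$ and $\mathcal G_H\subset\mathcal K(X)$ is the global attractor of $H_{\mathcal F}$, then $$\mathcal G_H\subset\mathcal K(\mathcal G_{\mathcal F})\qquad\text{and}\qquad \mathcal G_{\mathcal F}=\bigcup_{A\in\mathcal G_H}A.$$
   Context: An iterated function system (IFS) on a locally compact metric space $(Y,d_Y)$ is a finite collection $\mathcal F=\{f_1,\dots,f_m\}$, $m\ge1$, of continuous maps $f_i:Y\to Y$. For a finite word $I=i_1\dots i_k$ ($k\ge 0$) in the alphabet $\{1,\dots,m\}$, $|I|=k$ and $\Phi^I_{\mathcal F}=f_{i_1}\circ\dots\circ f_{i_k}$ (the identity for the empty word). A set $A\subset Y$ is $H$-invariant if $\bigcup_{i=1}^m f_i(A)=A$. With $N_\varepsilon(A)=\{y: d_Y(y,A)<\varepsilon\}$, $A$ attracts $K\subset Y$ if for every $\varepsilon>0$ there is $\tau>0$ such that $\Phi^I_{\mathcal F}(K)\subset N_\varepsilon(A)$ for every word $I$ with $|I|\ge\tau$. A global attractor of $\mathcal F$ is a non-empty compact $H$-invariant subset of $Y$ that attracts every compact subset of $Y$; it is unique when it exists. $\mathcal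 F$ has compact dynamics if it has a global attractor. For a metric space $(X,d)$, $\mathcal K(X)$ is the space of all non-empty compact subsets of $X$, with the Hausdorff metric $d_H(A,B)=\max\{\sup_{a\in A}d(a,B),\sup_{b\in B}d(b,A)\}$; it is locally compact when $X$ is. The Hutchinson map of an IFS $\mathcal F=\{f_1,\dots,f_m\}$ on $X$ is $H_{\mathcal F}:\mathcal K(X)\to\mathcal K(X)$, $H_{\mathcal F}(K)=\bigcup_{i=1}^m f_i(K)$. It is regarded as an IFS with a single map on $(\mathcal K(X),d_H)$, and the notions above (compact dynamics, global attractor) apply to it in that sense; in particular for a single map $H$-invariance means that the set equals its image. *)

theory Defs
  imports "HOL-Analysis.Analysis"
begin

section \<open>Iterated function systems and global attractors\<close>

text \<open>The maps of an IFS are constrained only on the carrier of the metric space; their values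
  elsewhere play no role.  Letters of words are the list indices \<open>0, \<dots>, m - 1\<close>.\<close>

definition ifs :: "'a metric \<Rightarrow> ('a \<Rightarrow> 'a) list \<Rightarrow> bool" where
  "ifs Y F \<longleftrightarrow> locally_compact_space (mtopology_of Y) \<and> F \<noteq> [] \<and>
     (\<forall>f\<in>set F. continuous_map (mtopology_of Y) (mtopology_of Y) f)"

definition words :: "('a \<Rightarrow> 'a) list \<Rightarrow> nat list set" where
  "words F = {I. set I \<subseteq> {..<length F}}"

definition word_map :: "('a \<Rightarrow> 'a) list \<Rightarrow> nat list \<Rightarrow> 'a \<Rightarrow> 'a" where
  "word_map F I = foldr (\<lambda>i g. (F ! i) \<circ> g) I id"

definition hutchinson :: "('a \<Rightarrow> 'a) list \<Rightarrow> 'a set \<Rightarrow> 'a set" where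
  "hutchinson F K = (\<Union>f\<in>set F. f ` K)"

text \<open>As a real infimum, this is meaningful only for non-empty \<open>A\<close>, the only case needed.\<close>

definition point_set_dist :: "'a metric \<Rightarrow> 'a \<Rightarrow> 'a set \<Rightarrow> real" where
  "point_set_dist Y y A = (INF a\<in>A. mdist Y y a)"

definition eps_nbhd :: "'a metric \<Rightarrow> real \<Rightarrow> 'a set \<Rightarrow> 'a set" where
  "eps_nbhd Y \<epsilon> A = {y \<in> mspace Y. point_set_dist Y y A < \<epsilon>}"

definition attracts :: "'a metric \<Rightarrow> ('a \<Rightarrow> 'a) list \<Rightarrow> 'a set \<Rightarrow> 'a set \<Rightarrow> bool" where
  "attracts Y F A K \<longleftrightarrow>
     (\<forall>\<epsilon>>0. \<exists>\<tau>>0. \<forall>I\<in>words F. real (length I) \<ge> \<tau> \<longrightarrow> word_map F I ` K \<subseteq> eps_nbhd Y \<epsilon> A)"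

definition global_attractor :: "'a metric \<Rightarrow> ('a \<Rightarrow> 'a) list \<Rightarrow> 'a set \<Rightarrow> bool" where
  "global_attractor Y F A \<longleftrightarrow>
     A \<noteq> {} \<and> compactin (mtopology_of Y) A \<and> (\<Union>f\<in>set F. f ` A) = A \<and>
     (\<forall>K. compactin (mtopology_of Y) K \<longrightarrow> attracts Y F A K)"

definition compact_dynamics :: "'a metric \<Rightarrow> ('a \<Rightarrow> 'a) list \<Rightarrow> bool" where
  "compact_dynamics Y F \<longleftrightarrow> (\<exists>A. global_attractor Y F A)"


section \<open>The space of non-empty compact subsets\<close>

definition compacts :: "'a metric \<Rightarrow> 'a set set" where
  "compacts X = {K. K \<noteq> {} \<and> compactin (mtopology_of X) K}"

text \<open>The distance is set to \<open>0\<close> outside \<open>compacts X\<close> because the library's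
  metrics are required to be symmetric and nonnegative on the whole type.\<close>

definition hausdorff_dist :: "'a metric \<Rightarrow> 'a set \<Rightarrow> 'a set \<Rightarrow> real" where
  "hausdorff_dist X A B =
     (if A \<in> compacts X \<and> B \<in> compacts X
      then max (SUP a\<in>A. point_set_dist X a B) (SUP b\<in>B. point_set_dist X b A)
      else 0)"

definition hyperspace :: "'a metric \<Rightarrow> 'a set metric" where
  "hyperspace X = metric (compacts X, hausdorff_dist X)"

lemma compacts_subset: "A \<in> compacts X \<Longrightarrow> A \<subseteq> mspace X"
  unfolding compacts_def using compactin_subset_topspace by fastforce

lemma point_set_dist_le:
  assumes "b \<in> B" shows "point_set_dist X a B \<le> mdist X a b"
  unfolding point_set_dist_def
  by (rule cINF_lower[OF _ assms]) (auto intro: bdd_belowI2[where m = 0])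

lemma point_set_dist_nonneg: "B \<noteq> {} \<Longrightarrow> 0 \<le> point_set_dist X a B"
  unfolding point_set_dist_def by (rule cINF_greatest) auto

lemma point_set_dist_approx:
  assumes "B \<noteq> {}" "point_set_dist X a B < c"
  obtains b where "b \<in> B" "mdist X a b < c"
  using assms cINF_greatest[of B c "mdist X a"] unfolding point_set_dist_def by force

lemma compacts_dist_bounded:
  assumes "A \<in> compacts X" "B \<in> compacts X"
  obtains C where "\<And>a b. a \<in> A \<Longrightarrow> b \<in> B \<Longrightarrow> mdist X a b \<le> C"
proof -
  interpret Metric_space "mspace X" "mdist X" by (rule Metric_space_mspace_mdist)
  have "compactin mtopology (A \<union> B)"
    using assms by (simp add: compacts_def mtopology_of_def compactin_Un)
  then have "mbounded (A \<union> B)" by (rule compactin_imp_mbounded)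
  then obtain C where "\<forall>x\<in>A \<union> B. \<forall>y\<in>A \<union> B. mdist X x y \<le> C"
    unfolding mbounded_alt by blast
  then show thesis by (intro that) blast
qed

lemma point_set_dist_le_hausdorff:
  assumes A: "A \<in> compacts X" and B: "B \<in> compacts X" and a: "a \<in> A"
  shows "point_set_dist X a B \<le> hausdorff_dist X A B"
proof -
  obtain C where C: "\<And>a b. a \<in> A \<Longrightarrow> b \<in> B \<Longrightarrow> mdist X a b \<le> C"
    using compacts_dist_bounded[OF A B] by blast
  obtain b where b: "b \<in> B" using B by (auto simp: compacts_def)
  have "bdd_above ((\<lambda>a. point_set_dist X a B) ` A)"
    using order_trans[OF point_set_dist_le[OF b] C[OF _ b]] by (intro bdd_aboveI2[where M = C])
  then have "point_set_dist X a B \<le> (SUP a\<in>A. point_set_dist X a B)"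
    by (rule cSUP_upper[OF a])
  then show ?thesis using A B by (simp add: hausdorff_dist_def)
qed

lemma hausdorff_dist_le:
  assumes A: "A \<in> compacts X" and B: "B \<in> compacts X"
    and "\<And>a. a \<in> A \<Longrightarrow> point_set_dist X a B \<le> c"
    and "\<And>b. b \<in> B \<Longrightarrow> point_set_dist X b A \<le> c"
  shows "hausdorff_dist X A B \<le> c"
  using assms by (auto simp: hausdorff_dist_def compacts_def intro!: cSUP_least)

lemma hausdorff_dist_commute: "hausdorff_dist X A B = hausdorff_dist X B A"
  by (simp add: hausdorff_dist_def max.commute)

lemma hausdorff_dist_nonneg: "0 \<le> hausdorff_dist X A B"
proof (cases "A \<in> compacts X \<and> B \<in> compacts X")
  case True
  then obtain a where "a \<in> A" by (auto simp: compacts_def)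
  with True have "point_set_dist X a B \<le> hausdorff_dist X A B"
    by (intro point_set_dist_le_hausdorff) auto
  moreover have "0 \<le> point_set_dist X a B"
    using True by (intro point_set_dist_nonneg) (auto simp: compacts_def)
  ultimately show ?thesis by linarith
next
  case False
  then show ?thesis unfolding hausdorff_dist_def by auto
qed

lemma hausdorff_dist_zero_subset:
  assumes A: "A \<in> compacts X" and B: "B \<in> compacts X" and 0: "hausdorff_dist X A B = 0"
  shows "A \<subseteq> B"
proof
  fix a assume a: "a \<in> A"
  interpret Metric_space "mspace X" "mdist X" by (rule Metric_space_mspace_mdist)
  have "closedin mtopology B"
    using B Hausdorff_space_mtopology compactin_imp_closedin
    by (auto simp: compacts_def mtopology_of_def)
  moreover have "a \<in> mtopology closure_of B"
  proof -
    have aX: "a \<in> mspace X" using a A compacts_subset by blast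
    have "\<exists>y\<in>B. y \<in> mball a r" if "0 < r" for r
    proof -
      have "point_set_dist X a B < r"
        using point_set_dist_le_hausdorff[OF A B a] 0 that by simp
      then obtain b where "b \<in> B" "mdist X a b < r"
        using B point_set_dist_approx[of B X a r] by (auto simp: compacts_def)
      then show ?thesis using aX B compacts_subset by (auto simp: in_mball)
    qed
    with aX show ?thesis by (simp add: metric_closure_of)
  qed
  ultimately show "a \<in> B" by (simp add: closure_of_closedin)
qed

lemma hausdorff_dist_self: "A \<in> compacts X \<Longrightarrow> hausdorff_dist X A A = 0"
proof -
  assume A: "A \<in> compacts X"
  interpret Metric_space "mspace X" "mdist X" by (rule Metric_space_mspace_mdist)
  have "point_set_dist X a A \<le> 0" if "a \<in> A" for a
    using point_set_dist_le[OF that, of X a] that A compacts_subset[OF A] zero[of a a] by auto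
  then have "hausdorff_dist X A A \<le> 0" by (intro hausdorff_dist_le A)
  then show ?thesis using hausdorff_dist_nonneg[of X A A] by linarith
qed

lemma point_set_dist_triangle:
  assumes A: "A \<in> compacts X" and B: "B \<in> compacts X" and C: "C \<in> compacts X" and a: "a \<in> A"
  shows "point_set_dist X a C \<le> hausdorff_dist X A B + hausdorff_dist X B C"
proof (rule field_le_epsilon)
  fix e :: real assume e: "0 < e"
  interpret Metric_space "mspace X" "mdist X" by (rule Metric_space_mspace_mdist)
  have "point_set_dist X a B < hausdorff_dist X A B + e / 2"
    using point_set_dist_le_hausdorff[OF A B a] e by simp
  then obtain b where b: "b \<in> B" "mdist X a b < hausdorff_dist X A B + e / 2"
    using B point_set_dist_approx by (metis (mono_tags, lifting) compacts_def mem_Collect_eq)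
  have "point_set_dist X b C < hausdorff_dist X B C + e / 2"
    using point_set_dist_le_hausdorff[OF B C b(1)] e by simp
  then obtain c where c: "c \<in> C" "mdist X b c < hausdorff_dist X B C + e / 2"
    using C point_set_dist_approx by (metis (mono_tags, lifting) compacts_def mem_Collect_eq)
  have "mdist X a c \<le> mdist X a b + mdist X b c"
    using a b c A B C compacts_subset by (intro triangle) blast+
  then show "point_set_dist X a C \<le> hausdorff_dist X A B + hausdorff_dist X B C + e"
    using point_set_dist_le[OF c(1), of X a] b c by linarith
qed

lemma Metric_space_hausdorff: "Metric_space (compacts X) (hausdorff_dist X)"
proof
  show "0 \<le> hausdorff_dist X A B" for A B by (rule hausdorff_dist_nonneg)
  show "hausdorff_dist X A B = hausdorff_dist X B A" for A B by (rule hausdorff_dist_commute)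
  show "hausdorff_dist X A B = 0 \<longleftrightarrow> A = B" if "A \<in> compacts X" "B \<in> compacts X" for A B
    using that hausdorff_dist_self hausdorff_dist_zero_subset hausdorff_dist_commute
    by (metis subset_antisym)
  show "hausdorff_dist X A C \<le> hausdorff_dist X A B + hausdorff_dist X B C"
    if "A \<in> compacts X" "B \<in> compacts X" "C \<in> compacts X" for A B C
  proof (rule hausdorff_dist_le)
    show "point_set_dist X c A \<le> hausdorff_dist X A B + hausdorff_dist X B C" if "c \<in> C" for c
      using point_set_dist_triangle[of C X B A c] that
        \<open>A \<in> compacts X\<close> \<open>B \<in> compacts X\<close> \<open>C \<in> compacts X\<close>
      by (simp add: hausdorff_dist_commute add.commute)
  qed (use that point_set_dist_triangle in auto)
qed

lemma mspace_hyperspace [simp]: "mspace (hyperspace X) = compacts X"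
  unfolding hyperspace_def by (rule Metric_space.mspace_metric[OF Metric_space_hausdorff])

lemma mdist_hyperspace [simp]: "mdist (hyperspace X) = hausdorff_dist X"
  unfolding hyperspace_def by (rule Metric_space.mdist_metric[OF Metric_space_hausdorff])

lemma hutchinson_compacts:
  assumes "ifs X F" "K \<in> compacts X"
  shows "hutchinson F K \<in> compacts X"
  using assms unfolding ifs_def compacts_def hutchinson_def
  by (auto intro!: compactin_Union image_compactin)

lemma compacts_submetric:
  "A \<subseteq> mspace X \<Longrightarrow> compacts (submetric X A) = {K \<in> compacts X. K \<subseteq> A}"
  by (auto simp: compacts_def mtopology_of_submetric compactin_subtopology)

end

theory Submission
  imports Defs
begin

text \<open>The Hausdorff metric on the non-empty compact sets induces the Vietoris topology, whose
  subbasic open sets are \<open>{K. K \<subseteq> U}\<close> and \<open>{K. K \<inter> U \<noteq> {}}\<close> for open \<open>U\<close>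
  (\<open>vietoris_subbase_topology\<close>).  Once this is known, distances disappear from the argument.  The
  Hutchinson map is continuous, because the preimage of a subbasic set is again a subbasic set.
  The non-empty compact subsets of a compact \<open>W\<close> form a compact family, by the Alexander subbase theorem
  (\<open>compactin_hyperspace_compact_subsets\<close>), and a compact family of compact sets has a
  compact union (\<open>compactin_Union_hyperspace\<close>).

  The images of \<open>K\<close> under the words of length \<open>k\<close> together form \<open>H\<^sup>k(K)\<close>, where \<open>H\<close> is the
  Hutchinson map.  A non-empty compact invariant set \<open>A\<close> is therefore the global attractor exactly when,
  for each compact \<open>K\<close> and each open \<open>U \<supseteq> A\<close>, eventually \<open>H\<^sup>k(K) \<subseteq> U\<close>
  (\<open>global_attractor_iff_open_nbhds\<close>).

  If \<open>\<G>\<close> is the global attractor of \<open>H\<close>, then \<open>\<Union>\<G>\<close> is the global attractor of \<open>F\<close>: for open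
  \<open>U \<supseteq> \<Union>\<G>\<close> the family \<open>{L. L \<subseteq> U}\<close> is an open neighbourhood of \<open>\<G>\<close>, so it eventually contains
  \<open>H\<^sup>k(K)\<close>.  Since global attractors are unique, this also gives \<open>G\<^sub>F = \<Union>G\<^sub>H\<close>, and hence that the
  members of \<open>G\<^sub>H\<close> are subsets of \<open>G\<^sub>F\<close>.

  Conversely, let \<open>F\<close> have a global attractor.  By local compactness it has a compact neighbourhood,
  whose first few iterates unite to a compact set \<open>W\<close> with \<open>H(W) \<subseteq> W\<close> that absorbs every compact
  set (\<open>absorbing_compact_set_exists\<close>).  The family \<open>\<C>\<close> of non-empty compact subsets of \<open>W\<close> is then
  compact, is mapped into itself by \<open>H\<close> and absorbs every compact family, so that the intersection of
  its iterates under \<open>H\<close> is a global attractor of \<open>H\<close>.\<close>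

section \<open>Neighbourhoods of compact sets\<close>

lemma Hausdorff_space_mtopology_of: "Hausdorff_space (mtopology_of X)"
  unfolding mtopology_of_def
  by (rule Metric_space.Hausdorff_space_mtopology[OF Metric_space_mspace_mdist])

lemma compacts_compactin: "K \<in> compacts X \<Longrightarrow> compactin (mtopology_of X) K"
  by (simp add: compacts_def)

lemma compacts_nonempty: "K \<in> compacts X \<Longrightarrow> K \<noteq> {}"
  by (simp add: compacts_def)

lemma point_set_dist_less_iff:
  assumes "A \<noteq> {}"
  shows "point_set_dist X y A < \<epsilon> \<longleftrightarrow> (\<exists>a\<in>A. mdist X y a < \<epsilon>)"
  using point_set_dist_approx[OF assms] point_set_dist_le by (metis le_less_trans)

lemma openin_eps_nbhd:
  assumes "A \<in> compacts X"
  shows "openin (mtopology_of X) (eps_nbhd X \<epsilon> A)"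
proof -
  interpret Metric_space "mspace X" "mdist X" by (rule Metric_space_mspace_mdist)
  have "eps_nbhd X \<epsilon> A = (\<Union>a\<in>A. mball a \<epsilon>)"
    using point_set_dist_less_iff[OF compacts_nonempty[OF assms]] subsetD[OF compacts_subset[OF assms]]
    by (fastforce simp: eps_nbhd_def in_mball commute)
  then show ?thesis
    by (auto simp: mtopology_of_def)
qed

lemma subset_eps_nbhd:
  assumes "A \<in> compacts X" "0 < \<epsilon>"
  shows "A \<subseteq> eps_nbhd X \<epsilon> A"
proof -
  interpret Metric_space "mspace X" "mdist X" by (rule Metric_space_mspace_mdist)
  show ?thesis
    using compacts_subset[OF assms(1)] point_set_dist_less_iff[OF compacts_nonempty[OF assms(1)]]
      assms(2) zero by (fastforce simp: eps_nbhd_def)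
qed

lemma compact_subset_open_imp_eps_nbhd_subset:
  assumes A: "A \<in> compacts X" and U: "openin (mtopology_of X) U" and "A \<subseteq> U"
  obtains \<epsilon> where "0 < \<epsilon>" "eps_nbhd X \<epsilon> A \<subseteq> U"
proof -
  interpret Metric_space "mspace X" "mdist X" by (rule Metric_space_mspace_mdist)
  obtain \<epsilon> where \<epsilon>: "0 < \<epsilon>" "\<And>a. a \<in> A \<Longrightarrow> mball a \<epsilon> \<subseteq> U"
    using lebesgue_number[of A "{U}"] A U \<open>A \<subseteq> U\<close>
    by (auto simp: compacts_def mtopology_of_def)
  have "eps_nbhd X \<epsilon> A \<subseteq> U"
  proof
    fix y assume "y \<in> eps_nbhd X \<epsilon> A"
    then obtain a where "a \<in> A" "y \<in> mball a \<epsilon>"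
      using compacts_subset[OF A] point_set_dist_less_iff[OF compacts_nonempty[OF A]]
      by (auto simp: eps_nbhd_def in_mball commute)
    then show "y \<in> U" using \<epsilon> by blast
  qed
  then show thesis using \<epsilon> that by blast
qed

section \<open>The Hausdorff metric induces the Vietoris topology\<close>

definition vietoris_subbase :: "'a metric \<Rightarrow> 'a set set set" where
  "vietoris_subbase X =
     (\<lambda>U. {K \<in> compacts X. K \<subseteq> U}) ` {U. openin (mtopology_of X) U} \<union>
     (\<lambda>U. {K \<in> compacts X. K \<inter> U \<noteq> {}}) ` {U. openin (mtopology_of X) U}"

lemma hausdorff_dist_less:
  assumes K: "K \<in> compacts X" and L: "L \<in> compacts X" and lt: "hausdorff_dist X K L < \<epsilon>"
  shows "L \<subseteq> eps_nbhd X \<epsilon> K" "x \<in> K \<Longrightarrow> \<exists>y\<in>L. mdist X x y < \<epsilon>"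
proof -
  show "L \<subseteq> eps_nbhd X \<epsilon> K"
    using point_set_dist_le_hausdorff[OF L K] lt compacts_subset[OF L]
    by (fastforce simp: eps_nbhd_def hausdorff_dist_commute[of X L K])
  show "\<exists>y\<in>L. mdist X x y < \<epsilon>" if "x \<in> K"
    using point_set_dist_le_hausdorff[OF K L that] lt
    by (simp flip: point_set_dist_less_iff[OF compacts_nonempty[OF L]])
qed

lemma openin_hyperspace_iff:
  "openin (mtopology_of (hyperspace X)) \<U> \<longleftrightarrow>
     \<U> \<subseteq> compacts X \<and>
     (\<forall>K\<in>\<U>. \<exists>\<epsilon>>0. \<forall>L\<in>compacts X. hausdorff_dist X K L < \<epsilon> \<longrightarrow> L \<in> \<U>)"
proof -
  interpret H: Metric_space "compacts X" "hausdorff_dist X" by (rule Metric_space_hausdorff)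
  have "mtopology_of (hyperspace X) = H.mtopology" by (simp add: mtopology_of_def)
  moreover have "H.mball K \<epsilon> \<subseteq> \<U> \<longleftrightarrow> (\<forall>L\<in>compacts X. hausdorff_dist X K L < \<epsilon> \<longrightarrow> L \<in> \<U>)"
    if "K \<in> compacts X" for K \<epsilon>
    using that by (auto simp: H.in_mball)
  ultimately show ?thesis by (simp add: H.openin_mtopology subset_iff Ball_def cong: conj_cong imp_cong)
qed

text \<open>A compact set contained in an open \<open>U\<close> has a whole \<open>\<epsilon>\<close>-neighbourhood inside \<open>U\<close>, and
  a compact set hitting \<open>U\<close> contains the centre of a ball inside \<open>U\<close>.  Sets closer than
  \<open>\<epsilon>\<close> in the Hausdorff metric are thus contained in \<open>U\<close>, respectively hit \<open>U\<close>.\<close>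

lemma openin_hyperspace_vietoris_subbase:
  assumes "\<U> \<in> vietoris_subbase X"
  shows "openin (mtopology_of (hyperspace X)) \<U>"
proof -
  consider U where "openin (mtopology_of X) U" "\<U> = {K \<in> compacts X. K \<subseteq> U}"
    | U where "openin (mtopology_of X) U" "\<U> = {K \<in> compacts X. K \<inter> U \<noteq> {}}"
    using assms unfolding vietoris_subbase_def by blast
  then show ?thesis
  proof cases
    case 1
    have "\<exists>\<epsilon>>0. \<forall>L\<in>compacts X. hausdorff_dist X K L < \<epsilon> \<longrightarrow> L \<in> \<U>" if "K \<in> \<U>" for K
    proof -
      have K: "K \<in> compacts X" "K \<subseteq> U" using that 1 by auto
      obtain \<epsilon> where "0 < \<epsilon>" "eps_nbhd X \<epsilon> K \<subseteq> U"
        using compact_subset_open_imp_eps_nbhd_subset[OF K(1) 1(1) K(2)] .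
      then show ?thesis using hausdorff_dist_less(1)[OF K(1)] 1(2) by blast
    qed
    then show ?thesis using 1 by (auto simp: openin_hyperspace_iff)
  next
    case 2
    interpret Metric_space "mspace X" "mdist X" by (rule Metric_space_mspace_mdist)
    have "\<exists>\<epsilon>>0. \<forall>L\<in>compacts X. hausdorff_dist X K L < \<epsilon> \<longrightarrow> L \<in> \<U>" if "K \<in> \<U>" for K
    proof -
      obtain x where K: "K \<in> compacts X" and x: "x \<in> K" "x \<in> U"
        using \<open>K \<in> \<U>\<close> 2 by auto
      obtain \<epsilon> where \<epsilon>: "0 < \<epsilon>" "mball x \<epsilon> \<subseteq> U"
        using 2(1) x by (auto simp: mtopology_of_def openin_mtopology)
      have "L \<in> \<U>" if L: "L \<in> compacts X" "hausdorff_dist X K L < \<epsilon>" for L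
      proof -
        obtain y where "y \<in> L" "mdist X x y < \<epsilon>"
          using hausdorff_dist_less(2)[OF K L x(1)] by blast
        then have "y \<in> L \<inter> U"
          using \<epsilon>(2) subsetD[OF compacts_subset[OF K]] subsetD[OF compacts_subset[OF L(1)]] x(1)
          by (auto simp: in_mball subset_iff)
        then show ?thesis using L 2(2) by blast
      qed
      then show ?thesis using \<epsilon>(1) by blast
    qed
    then show ?thesis using 2 by (auto simp: openin_hyperspace_iff)
  qed
qed

text \<open>Cover \<open>K\<close> by finitely many balls of radius \<open>\<epsilon>/2\<close> centred in \<open>K\<close>.  A set \<open>L\<close> that
  stays in the \<open>\<epsilon>\<close>-neighbourhood of \<open>K\<close> and hits all these balls is within Hausdorff distance
  \<open>\<epsilon>\<close> of \<open>K\<close>.\<close>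

lemma vietoris_nbhd_in_hausdorff_ball:
  assumes K: "K \<in> compacts X" and "0 < \<epsilon>"
  obtains \<F> where "finite \<F>" "\<F> \<subseteq> vietoris_subbase X" "\<And>\<V>. \<V> \<in> \<F> \<Longrightarrow> K \<in> \<V>"
    "\<And>L. L \<in> compacts X \<Longrightarrow> L \<in> \<Inter>\<F> \<Longrightarrow> hausdorff_dist X K L \<le> \<epsilon>"
proof -
  interpret Metric_space "mspace X" "mdist X" by (rule Metric_space_mspace_mdist)
  have "\<exists>C. finite C \<and> C \<subseteq> K \<and> K \<subseteq> (\<Union>x\<in>C. mball x (\<epsilon>/2))"
    using compactin_imp_mtotally_bounded[of K] compacts_compactin[OF K] \<open>0 < \<epsilon>\<close>
    unfolding mtotally_bounded_def mtopology_of_def by (meson half_gt_zero)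
  then obtain C where C: "finite C" "C \<subseteq> K" "K \<subseteq> (\<Union>x\<in>C. mball x (\<epsilon>/2))" by blast
  define hit where "hit x = {L \<in> compacts X. L \<inter> mball x (\<epsilon>/2) \<noteq> {}}" for x
  define \<F> where "\<F> = insert {L \<in> compacts X. L \<subseteq> eps_nbhd X \<epsilon> K} (hit ` C)"
  show thesis
  proof
    show "finite \<F>" using C by (simp add: \<F>_def)
    have "openin (mtopology_of X) (mball x (\<epsilon>/2))" for x
      by (simp add: mtopology_of_def)
    then show "\<F> \<subseteq> vietoris_subbase X"
      using openin_eps_nbhd[OF K] by (auto simp: \<F>_def hit_def vietoris_subbase_def)
    have "x \<in> K \<inter> mball x (\<epsilon>/2)" if "x \<in> C" for x
      using that C(2) compacts_subset[OF K] \<open>0 < \<epsilon>\<close> by auto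
    then have "K \<in> hit x" if "x \<in> C" for x
      using that K by (auto simp only: hit_def)
    then show "K \<in> \<V>" if "\<V> \<in> \<F>" for \<V>
      using that K subset_eps_nbhd[OF K \<open>0 < \<epsilon>\<close>] by (auto simp: \<F>_def)
    show "hausdorff_dist X K L \<le> \<epsilon>" if L: "L \<in> compacts X" and LF: "L \<in> \<Inter>\<F>" for L
    proof (rule hausdorff_dist_le[OF K L])
      fix y assume "y \<in> L"
      then have "y \<in> eps_nbhd X \<epsilon> K" using LF by (auto simp: \<F>_def)
      then show "point_set_dist X y K \<le> \<epsilon>" by (simp add: eps_nbhd_def)
    next
      fix x assume x: "x \<in> K"
      then obtain c where c: "c \<in> C" "x \<in> mball c (\<epsilon>/2)" using C by blast
      then have "L \<in> hit c" using LF by (auto simp: \<F>_def)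
      then obtain y where y: "y \<in> L" "y \<in> mball c (\<epsilon>/2)" unfolding hit_def by blast
      have "mdist X x y \<le> mdist X x c + mdist X c y"
        using c y by (intro triangle) auto
      then have "mdist X x y \<le> \<epsilon>" using c y by (auto simp: in_mball commute)
      then show "point_set_dist X x L \<le> \<epsilon>"
        using point_set_dist_le[OF y(1), of X x] by linarith
    qed
  qed
qed

text \<open>The left-hand side is the form of a generated topology that the Alexander subbase
  theorem and the subbase criterion for continuity refer to.\<close>

lemma vietoris_subbase_topology:
  "topology (arbitrary union_of
     (finite intersection_of (\<lambda>\<V>. \<V> \<in> vietoris_subbase X) relative_to compacts X)) =
   mtopology_of (hyperspace X)" (is "?V = ?H")
proof (rule topology_eq[THEN iffD2], intro allI iffI)
  fix \<U> assume "openin ?V \<U>"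
  moreover have "openin ?H (compacts X)" by (metis mspace_hyperspace openin_topspace topspace_mtopology_of)
  ultimately show "openin ?H \<U>"
    using minimal_topology_subbase[of "\<lambda>\<V>. \<V> \<in> vietoris_subbase X"]
      openin_hyperspace_vietoris_subbase by blast
next
  fix \<U> assume \<U>: "openin ?H \<U>"
  show "openin ?V \<U>"
  proof (subst openin_subopen, intro ballI)
    fix K assume "K \<in> \<U>"
    then obtain \<epsilon> where K: "K \<in> compacts X" and "0 < \<epsilon>"
      and \<epsilon>: "\<And>L. L \<in> compacts X \<Longrightarrow> hausdorff_dist X K L < \<epsilon> \<Longrightarrow> L \<in> \<U>"
      using \<U> unfolding openin_hyperspace_iff by blast
    obtain \<F> where \<F>: "finite \<F>" "\<F> \<subseteq> vietoris_subbase X" "\<And>\<V>. \<V> \<in> \<F> \<Longrightarrow> K \<in> \<V>"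
      "\<And>L. L \<in> compacts X \<Longrightarrow> L \<in> \<Inter>\<F> \<Longrightarrow> hausdorff_dist X K L \<le> \<epsilon>/2"
      using vietoris_nbhd_in_hausdorff_ball[OF K, of "\<epsilon>/2"] \<open>0 < \<epsilon>\<close> by (metis half_gt_zero)
    have "(finite intersection_of (\<lambda>\<V>. \<V> \<in> vietoris_subbase X)) (\<Inter>\<F>)"
      using \<F>(1,2) by (auto simp: intersection_of_def)
    then have "openin ?V (compacts X \<inter> \<Inter>\<F>)"
      unfolding openin_subbase
      by (intro arbitrary_union_of_inc) (auto simp: relative_to_def)
    moreover have "K \<in> compacts X \<inter> \<Inter>\<F>" using K \<F>(3) by blast
    moreover have "compacts X \<inter> \<Inter>\<F> \<subseteq> \<U>"
    proof
      fix L assume L: "L \<in> compacts X \<inter> \<Inter>\<F>"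
      then have "hausdorff_dist X K L \<le> \<epsilon>/2" using \<F>(4) by blast
      then show "L \<in> \<U>" using \<epsilon> L \<open>0 < \<epsilon>\<close> by auto
    qed
    ultimately show "\<exists>T. openin ?V T \<and> K \<in> T \<and> T \<subseteq> \<U>" by blast
  qed
qed

text \<open>The union of the images of \<open>K\<close> lies in \<open>U\<close> iff \<open>K\<close> lies in the intersection of the
  preimages of \<open>U\<close>, and it hits \<open>U\<close> iff \<open>K\<close> hits their union.  These are open, since \<open>F\<close> is
  finite; the list must be non-empty for the images to be non-empty.  Two spaces are allowed because,
  for the single map \<open>id\<close>, this covers the inclusion of the hyperspace of a subspace.\<close>

lemma continuous_map_hyperspace_hutchinson:
  assumes "F \<noteq> []" and F: "\<And>f. f \<in> set F \<Longrightarrow> continuous_map (mtopology_of X) (mtopology_of Y) f"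
  shows "continuous_map (mtopology_of (hyperspace X)) (mtopology_of (hyperspace Y)) (hutchinson F)"
proof -
  have fX: "f x \<in> mspace Y" if "f \<in> set F" "x \<in> mspace X" for f x
    using continuous_map_image_subset_topspace[OF F[OF that(1)]] that by auto
  have H: "hutchinson F K \<in> compacts Y" if "K \<in> compacts X" for K
    using that assms unfolding compacts_def hutchinson_def
    by (auto intro!: compactin_Union image_compactin)
  have pre: "openin (mtopology_of X) {x \<in> mspace X. f x \<in> U}"
    if "openin (mtopology_of Y) U" "f \<in> set F" for f U
    using openin_continuous_map_preimage[OF F[OF that(2)] that(1)] by simp
  have "openin (mtopology_of (hyperspace X)) {K \<in> compacts X. hutchinson F K \<in> \<U>}"
    if \<U>: "\<U> \<in> vietoris_subbase Y" for \<U>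
  proof -
    consider U where "openin (mtopology_of Y) U" "\<U> = {K \<in> compacts Y. K \<subseteq> U}"
      | U where "openin (mtopology_of Y) U" "\<U> = {K \<in> compacts Y. K \<inter> U \<noteq> {}}"
      using \<U> unfolding vietoris_subbase_def by blast
    then have "{K \<in> compacts X. hutchinson F K \<in> \<U>} \<in> vietoris_subbase X"
    proof cases
      case 1
      define V where "V = (\<Inter>f\<in>set F. {x \<in> mspace X. f x \<in> U})"
      have "openin (mtopology_of X) V"
        unfolding V_def using pre[OF 1(1)] \<open>F \<noteq> []\<close> by (intro openin_INT2) auto
      moreover have "{K \<in> compacts X. hutchinson F K \<in> \<U>} = {K \<in> compacts X. K \<subseteq> V}"
        using H 1(2) compacts_subset by (fastforce simp: V_def hutchinson_def)
      ultimately show ?thesis unfolding vietoris_subbase_def by blast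
    next
      case 2
      define V where "V = (\<Union>f\<in>set F. {x \<in> mspace X. f x \<in> U})"
      have "openin (mtopology_of X) V"
        unfolding V_def using pre[OF 2(1)] by blast
      moreover have "{K \<in> compacts X. hutchinson F K \<in> \<U>} = {K \<in> compacts X. K \<inter> V \<noteq> {}}"
        using H 2(2) compacts_subset by (fastforce simp: V_def hutchinson_def)
      ultimately show ?thesis unfolding vietoris_subbase_def by blast
    qed
    then show ?thesis by (rule openin_hyperspace_vietoris_subbase)
  qed
  then show ?thesis
    using H by (subst continuous_map_into_topology_subbase_eq[OF vietoris_subbase_topology[symmetric]]) auto
qed

section \<open>Compactness in the hyperspace\<close>

text \<open>By the Alexander subbase theorem it suffices to treat a cover by subbasic sets.  Let
  \<open>C\<close> be the complement of the union of those \<open>U\<close> for which the cover has the member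
  \<open>{K. K \<inter> U \<noteq> {}}\<close>.  If \<open>C\<close> is non-empty, it is a point of the hyperspace hitting no such \<open>U\<close>,
  so the cover has a member \<open>{K. K \<subseteq> V}\<close> with \<open>C \<subseteq> V\<close>; if \<open>C\<close> is empty, take \<open>V = {}\<close>.  Finitely
  many of the \<open>U\<close> cover the complement of \<open>V\<close>, and a compact set that is not contained in \<open>V\<close> hits
  one of them.\<close>

lemma compact_space_hyperspace:
  assumes "compact_space (mtopology_of X)"
  shows "compact_space (mtopology_of (hyperspace X))"
proof (rule Alexander_subbase_alt[OF _ _ vietoris_subbase_topology])
  show "compacts X \<subseteq> \<Union>(vietoris_subbase X)"
    using compacts_subset openin_topspace[of "mtopology_of X"] unfolding vietoris_subbase_def
    by (fastforce simp: subset_iff)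
  fix \<C> assume \<C>: "\<C> \<subseteq> vietoris_subbase X" "compacts X \<subseteq> \<Union>\<C>"
  define sub where "sub U = {K \<in> compacts X. K \<subseteq> U}" for U
  define hit where "hit U = {K \<in> compacts X. K \<inter> U \<noteq> {}}" for U
  \<comment> \<open>the open sets whose hitting families belong to the cover\<close>
  define \<H> where "\<H> = {U. openin (mtopology_of X) U \<and> hit U \<in> \<C>}"
  have finite_cover: "\<exists>\<F>. finite \<F> \<and> \<F> \<subseteq> \<H> \<and> mspace X - V \<subseteq> \<Union>\<F>"
    if V: "openin (mtopology_of X) V" "mspace X \<subseteq> V \<union> \<Union>\<H>" for V
  proof -
    have "compactin (mtopology_of X) (mspace X - V)"
      using assms V(1) by (metis closedin_compact_space closedin_diff closedin_topspace topspace_mtopology_of)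
    moreover have "mspace X - V \<subseteq> \<Union>\<H>" using V(2) by blast
    ultimately show ?thesis unfolding compactin_def by (auto simp: \<H>_def)
  qed
  define C where "C = mspace X - \<Union>\<H>"
  have "openin (mtopology_of X) (\<Union>\<H>)" by (auto simp: \<H>_def)
  then have C_compact: "compactin (mtopology_of X) C" unfolding C_def
    using assms by (metis closedin_compact_space closedin_diff closedin_topspace topspace_mtopology_of)
  obtain V \<C>\<^sub>0 where V: "openin (mtopology_of X) V" "C \<subseteq> V"
    and \<C>\<^sub>0: "finite \<C>\<^sub>0" "\<C>\<^sub>0 \<subseteq> \<C>" "sub V \<subseteq> \<Union>\<C>\<^sub>0"
  proof (cases "C = {}")
    case True
    then show thesis using that[of "{}" "{}"] compacts_nonempty by (auto simp: sub_def)
  next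
    case False
    then have "C \<in> compacts X" using C_compact by (simp add: compacts_def)
    then obtain \<U> where \<U>: "\<U> \<in> \<C>" "C \<in> \<U>" using \<C>(2) by blast
    then have "\<U> \<in> vietoris_subbase X" using \<C>(1) by blast
    then consider U where "openin (mtopology_of X) U" "\<U> = sub U"
      | U where "openin (mtopology_of X) U" "\<U> = hit U"
      unfolding vietoris_subbase_def sub_def hit_def by blast
    then show thesis
    proof cases
      case 1
      then show thesis using that[of U "{\<U>}"] \<U> by (auto simp: sub_def)
    next
      case 2
      then have "U \<in> \<H>" using \<U> by (simp add: \<H>_def)
      then have "C \<inter> U = {}" by (auto simp: C_def)
      then show thesis using 2 \<U> by (simp add: hit_def)
    qed
  qed
  have "mspace X \<subseteq> V \<union> \<Union>\<H>" using V(2) by (auto simp: C_def)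
  then obtain \<F> where \<F>: "finite \<F>" "\<F> \<subseteq> \<H>" "mspace X - V \<subseteq> \<Union>\<F>"
    using finite_cover[OF V(1)] by blast
  have "K \<in> \<Union>(\<C>\<^sub>0 \<union> hit ` \<F>)" if K: "K \<in> compacts X" for K
  proof (cases "K \<subseteq> V")
    case True
    then show ?thesis using K \<C>\<^sub>0(3) by (auto simp: sub_def)
  next
    case False
    then obtain x where "x \<in> K" "x \<in> \<Union>\<F>" using \<F>(3) compacts_subset[OF K] by blast
    then show ?thesis using K by (auto simp: hit_def)
  qed
  moreover have "hit ` \<F> \<subseteq> \<C>" using \<F>(2) by (auto simp: \<H>_def)
  ultimately show "\<exists>\<C>'. finite \<C>' \<and> \<C>' \<subseteq> \<C> \<and> compacts X \<subseteq> \<Union>\<C>'"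
    using \<C>\<^sub>0 \<F>(1) by (intro exI[of _ "\<C>\<^sub>0 \<union> hit ` \<F>"]) blast
qed

text \<open>The hyperspace of the subspace \<open>W\<close> is compact, and its inclusion, which is the
  Hutchinson map of the single map \<open>id\<close>, is continuous.\<close>

lemma compactin_hyperspace_compact_subsets:
  assumes "compactin (mtopology_of X) W"
  shows "compactin (mtopology_of (hyperspace X)) {K \<in> compacts X. K \<subseteq> W}"
proof -
  let ?Y = "submetric X W"
  have W: "W \<subseteq> mspace X" using compactin_subset_topspace[OF assms] by simp
  have "compact_space (mtopology_of (hyperspace ?Y))"
    using assms by (intro compact_space_hyperspace) (simp add: mtopology_of_submetric compact_space_subtopology)
  then have *: "compactin (mtopology_of (hyperspace ?Y)) {K \<in> compacts X. K \<subseteq> W}"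
    by (simp add: compact_space_def compacts_submetric[OF W])
  have id: "hutchinson [id] = id" by (auto simp: hutchinson_def)
  have "continuous_map (mtopology_of (hyperspace ?Y)) (mtopology_of (hyperspace X)) (hutchinson [id])"
    by (rule continuous_map_hyperspace_hutchinson)
       (auto simp: mtopology_of_submetric intro: continuous_map_from_subtopology)
  from image_compactin[OF * this] show ?thesis by (simp add: id)
qed

text \<open>Given an open cover \<open>\<U>\<close> of \<open>\<Union>\<K>\<close>, each member of \<open>\<K>\<close> lies in the union of a finite
  subfamily \<open>\<F>\<close> of \<open>\<U>\<close>; the families \<open>{K. K \<subseteq> \<Union>\<F>}\<close> are open and cover \<open>\<K>\<close>, so finitely many
  \<open>\<F>\<close> suffice.\<close>

lemma compactin_Union_hyperspace:
  assumes "compactin (mtopology_of (hyperspace X)) \<K>"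
  shows "compactin (mtopology_of X) (\<Union>\<K>)"
proof -
  have \<K>: "\<K> \<subseteq> compacts X" using compactin_subset_topspace[OF assms] by simp
  have "\<exists>\<F>. finite \<F> \<and> \<F> \<subseteq> \<U> \<and> \<Union>\<K> \<subseteq> \<Union>\<F>"
    if \<U>: "\<And>U. U \<in> \<U> \<Longrightarrow> openin (mtopology_of X) U" "\<Union>\<K> \<subseteq> \<Union>\<U>" for \<U>
  proof -
    define sub where "sub \<F> = {K \<in> compacts X. K \<subseteq> \<Union>\<F>}" for \<F>
    define \<S> where "\<S> = {\<F>. finite \<F> \<and> \<F> \<subseteq> \<U>}"
    have "openin (mtopology_of (hyperspace X)) (sub \<F>)" if "\<F> \<in> \<S>" for \<F>
      using that \<U>(1) by (intro openin_hyperspace_vietoris_subbase)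
        (auto simp: \<S>_def sub_def vietoris_subbase_def)
    moreover have "\<K> \<subseteq> \<Union>(sub ` \<S>)"
    proof
      fix K assume K: "K \<in> \<K>"
      then have "compactin (mtopology_of X) K" "K \<subseteq> \<Union>\<U>"
        using \<K> \<U>(2) by (auto simp: compacts_def)
      then obtain \<F> where "finite \<F>" "\<F> \<subseteq> \<U>" "K \<subseteq> \<Union>\<F>"
        using \<U>(1) unfolding compactin_def by blast
      then show "K \<in> \<Union>(sub ` \<S>)" using K \<K> by (auto simp: sub_def \<S>_def)
    qed
    ultimately obtain \<T> where \<T>: "finite \<T>" "\<T> \<subseteq> \<S>" "\<K> \<subseteq> \<Union>(sub ` \<T>)"
      using assms unfolding compactin_def by (smt (verit, best) finite_subset_image imageE)
    then have "finite (\<Union>\<T>)" "\<Union>\<T> \<subseteq> \<U>"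
      by (auto simp: \<S>_def)
    moreover have "\<Union>\<K> \<subseteq> \<Union>(\<Union>\<T>)"
    proof
      fix x assume "x \<in> \<Union>\<K>"
      then obtain \<F> where "\<F> \<in> \<T>" "x \<in> \<Union>\<F>" using \<T>(3) unfolding sub_def by blast
      then show "x \<in> \<Union>(\<Union>\<T>)" by blast
    qed
    ultimately show ?thesis by blast
  qed
  then show ?thesis
    using \<K> compacts_subset[of _ X] by (simp add: compactin_def Sup_le_iff subset_iff[of \<K>])
qed

section \<open>Iterates of a compact forward invariant set\<close>

lemma Hausdorff_compact_nest:
  fixes C :: "nat \<Rightarrow> 'a set"
  assumes "Hausdorff_space T" "decseq C" "\<And>n. compactin T (C n)" "\<And>n. C n \<noteq> {}"
  shows "(\<Inter>n. C n) \<noteq> {}"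
proof (rule compact_space_imp_nest)
  show "compact_space (subtopology T (C 0))"
    by (simp add: assms compact_space_subtopology)
  show "closedin (subtopology T (C 0)) (C n)" for n
    using assms by (intro closedin_subset_topspace) (auto simp: compactin_imp_closedin decseq_def)
qed (use assms in auto)

text \<open>All claims follow from the fact that a decreasing sequence of non-empty compact sets has
  non-empty intersection: for \<open>y \<in> A\<close> it is applied to the fibre of \<open>y\<close> in the iterates
  of \<open>C\<close>, which yields a preimage of \<open>y\<close> in \<open>A\<close>, and for open \<open>U \<supseteq> A\<close> it is applied to the parts of
  the iterates outside \<open>U\<close>.\<close>

lemma Inter_iterates_compact_attracts:
  assumes T: "Hausdorff_space T" and h: "continuous_map T T h"
    and C: "compactin T C" "C \<noteq> {}" "h ` C \<subseteq> C"
  defines "A \<equiv> \<Inter>n. (h ^^ n) ` C"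
  shows "compactin T A" "A \<noteq> {}" "h ` A = A"
    and "\<And>U. openin T U \<Longrightarrow> A \<subseteq> U \<Longrightarrow> \<exists>n. (h ^^ n) ` C \<subseteq> U"
proof -
  define D where "D n = (h ^^ n) ` C" for n
  have D_Suc: "D (Suc n) = h ` D n" for n by (simp add: D_def image_comp)
  have dec: "decseq D"
  proof (rule decseq_SucI)
    show "D (Suc n) \<subseteq> D n" for n
    proof (induction n)
      case 0
      then show ?case using C(3) by (simp add: D_def)
    next
      case (Suc n)
      then show ?case by (simp only: D_Suc image_mono)
    qed
  qed
  have comp: "compactin T (D n)" for n
  proof (induction n)
    case 0
    then show ?case using C by (simp add: D_def)
  next
    case (Suc n)
    then show ?case unfolding D_Suc using h by (rule image_compactin)
  qed
  have clo: "closedin T (D n)" for n using comp T by (simp add: compactin_imp_closedin)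
  have ne: "D n \<noteq> {}" for n using C by (simp add: D_def)
  have A: "A = (\<Inter>n. D n)" by (simp add: A_def D_def)
  show "A \<noteq> {}" unfolding A by (rule Hausdorff_compact_nest[OF T dec comp ne])
  have "closedin T A" unfolding A using clo by blast
  moreover have "A \<subseteq> D 0" by (auto simp: A)
  ultimately show "compactin T A" using comp closed_compactin by blast
  show "h ` A = A"
  proof
    have "h ` A \<subseteq> D (Suc n)" for n by (auto simp: A D_Suc)
    then show "h ` A \<subseteq> A" using decseq_SucD[OF dec] unfolding A by blast
    show "A \<subseteq> h ` A"
    proof
      fix y assume y: "y \<in> A"
      define E where "E n = D n \<inter> {x \<in> topspace T. h x \<in> {y}}" for n
      have "y \<in> topspace T" using y \<open>closedin T A\<close> closedin_subset by blast
      then have "closedin T {y}" using T by (simp add: closedin_Hausdorff_sing_eq)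
      then have "closedin T {x \<in> topspace T. h x \<in> {y}}"
        using closedin_continuous_map_preimage[OF h] by blast
      then have "compactin T (E n)" for n
        using comp by (simp add: E_def compact_Int_closedin)
      moreover have "E n \<noteq> {}" for n
      proof -
        have "y \<in> h ` D n" using y D_Suc unfolding A by blast
        then show ?thesis using compactin_subset_topspace[OF comp[of n]] by (auto simp: E_def)
      qed
      moreover have "decseq E" using dec by (auto simp: E_def decseq_def)
      ultimately have "(\<Inter>n. E n) \<noteq> {}" using Hausdorff_compact_nest[OF T] by blast
      then show "y \<in> h ` A" by (auto simp: A E_def)
    qed
  qed
  show "\<exists>n. (h ^^ n) ` C \<subseteq> U" if U: "openin T U" "A \<subseteq> U" for U
  proof (rule ccontr)
    assume "\<nexists>n. (h ^^ n) ` C \<subseteq> U"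
    then have "D n - U \<noteq> {}" for n unfolding D_def by blast
    moreover have "compactin T (D n - U)" for n
      using closed_compactin[OF comp[of n]] clo U(1) closedin_diff by blast
    moreover have "decseq (\<lambda>n. D n - U)" using dec by (auto simp: decseq_def)
    ultimately have "(\<Inter>n. D n - U) \<noteq> {}" using Hausdorff_compact_nest[OF T] by blast
    then show False using U(2) by (auto simp: A)
  qed
qed

section \<open>Iterates of the Hutchinson map\<close>

lemma hutchinson_UN: "hutchinson F (\<Union>i\<in>J. K i) = (\<Union>i\<in>J. hutchinson F (K i))"
  by (auto simp: hutchinson_def)

lemma hutchinson_mono: "K \<subseteq> L \<Longrightarrow> hutchinson F K \<subseteq> hutchinson F L"
  by (auto simp: hutchinson_def)

lemma funpow_hutchinson_mono: "K \<subseteq> L \<Longrightarrow> (hutchinson F ^^ n) K \<subseteq> (hutchinson F ^^ n) L"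
  by (induction n) (auto intro!: hutchinson_mono)

lemma hutchinson_singleton: "hutchinson [h] = image h"
  by (auto simp: hutchinson_def)

lemma funpow_hutchinson_singleton: "(hutchinson [h] ^^ n) K = (h ^^ n) ` K"
  by (induction n) (auto simp: hutchinson_singleton)

lemma compactin_funpow_hutchinson:
  assumes "ifs X F" "compactin (mtopology_of X) K"
  shows "compactin (mtopology_of X) ((hutchinson F ^^ n) K)"
  using assms by (induction n)
    (auto simp: ifs_def hutchinson_def intro!: compactin_Union image_compactin)

lemma funpow_hutchinson_eq_words:
  "(hutchinson F ^^ n) K = (\<Union>I\<in>{I \<in> words F. length I = n}. word_map F I ` K)"
proof (induction n)
  case 0
  have "{I \<in> words F. length I = 0} = {[]}" by (auto simp: words_def)
  then show ?case by (simp add: word_map_def)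
next
  case (Suc n)
  have words: "{I \<in> words F. length I = Suc n} =
      (\<Union>i\<in>{..<length F}. (#) i ` {I \<in> words F. length I = n})"
    by (auto simp: words_def length_Suc_conv image_iff)
  have set: "hutchinson F L = (\<Union>i\<in>{..<length F}. (F ! i) ` L)" for L
    by (auto simp: hutchinson_def set_conv_nth)
  have Cons: "word_map F (i # I) ` K = (F ! i) ` word_map F I ` K" for i I
    by (simp add: word_map_def image_comp)
  have "(hutchinson F ^^ Suc n) K = (\<Union>i\<in>{..<length F}. (F ! i) ` (hutchinson F ^^ n) K)"
    using set[of "(hutchinson F ^^ n) K"] by simp
  also have "\<dots> = (\<Union>i\<in>{..<length F}. \<Union>I\<in>{I \<in> words F. length I = n}. word_map F (i # I) ` K)"
    unfolding Suc.IH image_UN Cons ..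
  also have "\<dots> = (\<Union>I\<in>{I \<in> words F. length I = Suc n}. word_map F I ` K)"
    unfolding words by blast
  finally show ?case .
qed

text \<open>The \<open>\<epsilon>\<close>-neighbourhoods of a compact set form a base of its open neighbourhoods.\<close>

lemma attracts_iff_open_nbhds:
  assumes A: "A \<in> compacts Y"
  shows "attracts Y F A K \<longleftrightarrow>
    (\<forall>U. openin (mtopology_of Y) U \<longrightarrow> A \<subseteq> U \<longrightarrow> (\<exists>n. \<forall>k\<ge>n. (hutchinson F ^^ k) K \<subseteq> U))"
    (is "_ \<longleftrightarrow> ?R")
proof
  assume att: "attracts Y F A K"
  show ?R
  proof (intro allI impI)
    fix U assume "openin (mtopology_of Y) U" "A \<subseteq> U"
    then obtain \<epsilon> where \<epsilon>: "0 < \<epsilon>" "eps_nbhd Y \<epsilon> A \<subseteq> U"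
      using compact_subset_open_imp_eps_nbhd_subset[OF A] by blast
    then obtain \<tau> where \<tau>: "\<And>I. I \<in> words F \<Longrightarrow> \<tau> \<le> real (length I) \<Longrightarrow>
        word_map F I ` K \<subseteq> eps_nbhd Y \<epsilon> A"
      using att unfolding attracts_def by blast
    have "(hutchinson F ^^ k) K \<subseteq> U" if "nat \<lceil>\<tau>\<rceil> \<le> k" for k
    proof -
      have "\<tau> \<le> real k" using that by linarith
      then show ?thesis using \<tau> \<epsilon>(2) unfolding funpow_hutchinson_eq_words by blast
    qed
    then show "\<exists>n. \<forall>k\<ge>n. (hutchinson F ^^ k) K \<subseteq> U" by blast
  qed
next
  assume R: ?R
  show "attracts Y F A K"
    unfolding attracts_def
  proof (intro allI impI)
    fix \<epsilon> :: real assume "0 < \<epsilon>"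
    then obtain n where n: "\<And>k. n \<le> k \<Longrightarrow> (hutchinson F ^^ k) K \<subseteq> eps_nbhd Y \<epsilon> A"
      using R[rule_format, OF openin_eps_nbhd[OF A] subset_eps_nbhd[OF A]] by blast
    have "word_map F I ` K \<subseteq> eps_nbhd Y \<epsilon> A" if "I \<in> words F" "real (Suc n) \<le> real (length I)" for I
    proof -
      have "n \<le> length I" using that(2) by linarith
      then show ?thesis using n that(1) unfolding funpow_hutchinson_eq_words by blast
    qed
    then show "\<exists>\<tau>>0. \<forall>I\<in>words F. \<tau> \<le> real (length I) \<longrightarrow> word_map F I ` K \<subseteq> eps_nbhd Y \<epsilon> A"
      by (intro exI[of _ "real (Suc n)"]) auto
  qed
qed

lemma global_attractor_iff_open_nbhds:
  "global_attractor Y F A \<longleftrightarrow> A \<in> compacts Y \<and> hutchinson F A = A \<and>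
     (\<forall>K U. compactin (mtopology_of Y) K \<longrightarrow> openin (mtopology_of Y) U \<longrightarrow> A \<subseteq> U \<longrightarrow>
        (\<exists>n. \<forall>k\<ge>n. (hutchinson F ^^ k) K \<subseteq> U))"
proof (cases "A \<in> compacts Y")
  case True
  then show ?thesis
    using compacts_nonempty[OF True] compacts_compactin[OF True]
    by (simp add: global_attractor_def hutchinson_def[of F A] attracts_iff_open_nbhds[OF True])
next
  case False
  then show ?thesis by (auto simp: global_attractor_def compacts_def)
qed

text \<open>Uniqueness of the global attractor, with the two inclusions being symmetric.  The iterates of
  \<open>A\<close> are all equal to \<open>A\<close>, so every open neighbourhood of \<open>B\<close> contains \<open>A\<close>; for \<open>x \<notin> B\<close> the
  complement of \<open>{x}\<close> is such a neighbourhood.\<close>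

lemma global_attractor_subset:
  assumes A: "global_attractor Y F A" and B: "global_attractor Y F B"
  shows "A \<subseteq> B"
proof
  fix x assume x: "x \<in> A"
  have Ac: "compactin (mtopology_of Y) A" and inv: "hutchinson F A = A"
    using A by (auto simp: global_attractor_iff_open_nbhds compacts_def)
  have fix_A: "(hutchinson F ^^ k) A = A" for k by (induction k) (auto simp: inv)
  have "x \<in> mspace Y" using x compactin_subset_topspace[OF Ac] by auto
  then have "openin (mtopology_of Y) (mspace Y - {x})"
    using Hausdorff_space_mtopology_of[of Y]
    by (metis closedin_Hausdorff_sing_eq openin_diff openin_topspace topspace_mtopology_of)
  moreover have "B \<subseteq> mspace Y - {x}" if "x \<notin> B"
    using B that compacts_subset by (auto simp: global_attractor_iff_open_nbhds)
  ultimately have "\<exists>n. \<forall>k\<ge>n. (hutchinson F ^^ k) A \<subseteq> mspace Y - {x}" if "x \<notin> B"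
    using B Ac that by (simp add: global_attractor_iff_open_nbhds)
  then show "x \<in> B" using x unfolding fix_A by blast
qed

section \<open>Passing between the system and its Hutchinson map\<close>

lemma global_attractor_Union:
  assumes "global_attractor (hyperspace X) [hutchinson F] \<G>"
  shows "global_attractor X F (\<Union>\<G>)"
proof -
  have \<G>: "compactin (mtopology_of (hyperspace X)) \<G>" "\<G> \<noteq> {}" "hutchinson F ` \<G> = \<G>"
    and att: "\<And>\<K> \<U>. compactin (mtopology_of (hyperspace X)) \<K> \<Longrightarrow>
      openin (mtopology_of (hyperspace X)) \<U> \<Longrightarrow> \<G> \<subseteq> \<U> \<Longrightarrow>
      \<exists>n. \<forall>k\<ge>n. (hutchinson F ^^ k) ` \<K> \<subseteq> \<U>"
    using assms
    unfolding global_attractor_iff_open_nbhds funpow_hutchinson_singleton compacts_def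
    unfolding hutchinson_singleton by blast+
  have sub: "\<G> \<subseteq> compacts X" using compactin_subset_topspace[OF \<G>(1)] by simp
  then have "\<Union>\<G> \<in> compacts X"
    using compactin_Union_hyperspace[OF \<G>(1)] \<G>(2) by (auto simp: compacts_def)
  moreover have "hutchinson F (\<Union>\<G>) = \<Union>\<G>"
    using hutchinson_UN[of F id \<G>] \<G>(3) by simp
  moreover have "\<exists>n. \<forall>k\<ge>n. (hutchinson F ^^ k) K \<subseteq> U"
    if K: "compactin (mtopology_of X) K" and U: "openin (mtopology_of X) U" "\<Union>\<G> \<subseteq> U" for K U
  proof (cases "K = {}")
    case True
    have "(hutchinson F ^^ k) {} = {}" for k
      by (induction k) (auto simp: hutchinson_def)
    then show ?thesis using True by simp
  next
    case False
    then have "compactin (mtopology_of (hyperspace X)) {K}"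
      using K by (simp add: compacts_def)
    moreover have "openin (mtopology_of (hyperspace X)) {L \<in> compacts X. L \<subseteq> U}"
      using U(1) by (intro openin_hyperspace_vietoris_subbase) (auto simp: vietoris_subbase_def)
    moreover have "\<G> \<subseteq> {L \<in> compacts X. L \<subseteq> U}" using sub U(2) by blast
    ultimately have "\<exists>n. \<forall>k\<ge>n. (hutchinson F ^^ k) ` {K} \<subseteq> {L \<in> compacts X. L \<subseteq> U}" by (rule att)
    then show ?thesis by auto
  qed
  ultimately show ?thesis by (simp add: global_attractor_iff_open_nbhds)
qed

text \<open>Let \<open>L\<close> be a compact neighbourhood of \<open>G\<close> and let \<open>n\<close> be such that all iterates of \<open>L\<close>
  from the \<open>n\<close>-th on lie in \<open>L\<close>.  The union \<open>W\<close> of the iterates up to the \<open>n\<close>-th is mapped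
  into itself, because the \<open>(n+1)\<close>-st iterate is back in \<open>L\<close>.\<close>

lemma absorbing_compact_set_exists:
  assumes ifs: "ifs X F" and G: "global_attractor X F G"
  obtains W where "W \<in> compacts X" "hutchinson F W \<subseteq> W"
    "\<And>K. compactin (mtopology_of X) K \<Longrightarrow> \<exists>n. (hutchinson F ^^ n) K \<subseteq> W"
proof -
  have Gc: "G \<in> compacts X" and att: "\<And>K U. compactin (mtopology_of X) K \<Longrightarrow>
      openin (mtopology_of X) U \<Longrightarrow> G \<subseteq> U \<Longrightarrow> \<exists>n. \<forall>k\<ge>n. (hutchinson F ^^ k) K \<subseteq> U"
    using G unfolding global_attractor_iff_open_nbhds by blast+
  obtain U L where U: "openin (mtopology_of X) U" "G \<subseteq> U" "U \<subseteq> L"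
    and L: "compactin (mtopology_of X) L"
    using ifs compacts_compactin[OF Gc]
      locally_compact_space_compact_closed_compact[of "mtopology_of X"]
      Hausdorff_space_mtopology_of[of X] unfolding ifs_def by blast
  obtain n where n: "\<And>k. n \<le> k \<Longrightarrow> (hutchinson F ^^ k) L \<subseteq> U"
    using att[OF L U(1,2)] by blast
  define W where "W = (\<Union>k\<in>{..n}. (hutchinson F ^^ k) L)"
  have LW: "L \<subseteq> W" by (force simp: W_def)
  show thesis
  proof
    have "compactin (mtopology_of X) W"
      unfolding W_def using compactin_funpow_hutchinson[OF ifs L] by (intro compactin_Union) auto
    moreover have "W \<noteq> {}" using LW U compacts_nonempty[OF Gc] by blast
    ultimately show "W \<in> compacts X" by (simp add: compacts_def)
    have "(hutchinson F ^^ Suc k) L \<subseteq> W" if "k \<le> n" for k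
    proof (cases "k = n")
      case True
      then show ?thesis using n[of "Suc k"] U(3) LW by force
    next
      case False
      then have "Suc k \<in> {..n}" using that by simp
      then show ?thesis unfolding W_def by blast
    qed
    moreover have "hutchinson F W = (\<Union>k\<in>{..n}. (hutchinson F ^^ Suc k) L)"
      unfolding W_def by (simp add: hutchinson_UN)
    ultimately show "hutchinson F W \<subseteq> W" by blast
    show "\<exists>n. (hutchinson F ^^ n) K \<subseteq> W" if "compactin (mtopology_of X) K" for K
      using att[OF that U(1,2)] U(3) LW by blast
  qed
qed

lemma compact_dynamics_hyperspace:
  assumes ifs: "ifs X F" and "compact_dynamics X F"
  shows "compact_dynamics (hyperspace X) [hutchinson F]"
proof -
  let ?H = "hutchinson F" and ?T = "mtopology_of (hyperspace X)"
  obtain W where W: "W \<in> compacts X" "?H W \<subseteq> W"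
    and absorb: "\<And>K. compactin (mtopology_of X) K \<Longrightarrow> \<exists>n. (?H ^^ n) K \<subseteq> W"
    using absorbing_compact_set_exists[OF ifs] assms(2) unfolding compact_dynamics_def by metis
  define \<C> where "\<C> = {K \<in> compacts X. K \<subseteq> W}"
  have T: "Hausdorff_space ?T" by (rule Hausdorff_space_mtopology_of)
  have h: "continuous_map ?T ?T ?H"
    using ifs by (intro continuous_map_hyperspace_hutchinson) (auto simp: ifs_def)
  have \<C>: "compactin ?T \<C>" "\<C> \<noteq> {}"
    unfolding \<C>_def using W compactin_hyperspace_compact_subsets[OF compacts_compactin[OF W(1)]] by auto
  have "?H ` \<C> \<subseteq> \<C>"
    using hutchinson_compacts[OF ifs] W(2) hutchinson_mono[of _ W F]
    unfolding \<C>_def by blast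
  note inter = Inter_iterates_compact_attracts[OF T h \<C> this]
  define \<G> where "\<G> = (\<Inter>n. (?H ^^ n) ` \<C>)"
  have "\<exists>n. \<forall>k\<ge>n. (?H ^^ k) ` \<K> \<subseteq> \<U>"
    if \<K>: "compactin ?T \<K>" and \<U>: "openin ?T \<U>" "\<G> \<subseteq> \<U>" for \<K> \<U>
  proof -
    \<comment> \<open>After \<open>q\<close> steps all members of \<open>\<K>\<close> are inside \<open>W\<close>, since their union is; from there
      \<open>p\<close> further steps lead into \<open>\<U>\<close>.\<close>
    obtain p where p: "(?H ^^ p) ` \<C> \<subseteq> \<U>"
      using inter(4)[OF \<U>(1)] \<U>(2) unfolding \<G>_def by blast
    obtain q where q: "(?H ^^ q) (\<Union>\<K>) \<subseteq> W"
      using absorb[OF compactin_Union_hyperspace[OF \<K>]] by blast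
    have in_\<C>: "(?H ^^ k) K \<in> \<C>" if "K \<in> \<K>" "q \<le> k" for k K
    proof -
      have K: "K \<in> compacts X" using compactin_subset_topspace[OF \<K>] that(1) by auto
      have "(?H ^^ j) K \<in> compacts X" for j
        by (induction j) (use K hutchinson_compacts[OF ifs] in auto)
      moreover have "(?H ^^ (q + j)) K \<subseteq> W" for j
      proof (induction j)
        case 0
        then show ?case
          using q funpow_hutchinson_mono[of K "\<Union>\<K>" q F] that(1) by auto
      next
        case (Suc j)
        then have "?H ((?H ^^ (q + j)) K) \<subseteq> W"
          using W(2) hutchinson_mono[of _ W F] by blast
        then show ?case by simp
      qed
      ultimately show ?thesis using le_Suc_ex[OF that(2)] by (auto simp: \<C>_def)
    qed
    have "(?H ^^ k) K \<in> \<U>" if "p + q \<le> k" "K \<in> \<K>" for k K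
    proof -
      have "(?H ^^ k) K = (?H ^^ p) ((?H ^^ (k - p)) K)"
        using that(1) by (metis add_leD1 comp_apply funpow_add le_add_diff_inverse)
      moreover have "(?H ^^ (k - p)) K \<in> \<C>" using that by (intro in_\<C>) auto
      ultimately show ?thesis using p by blast
    qed
    then show ?thesis by blast
  qed
  moreover have "\<G> \<in> compacts (hyperspace X)" "?H ` \<G> = \<G>"
    using inter(1-3) unfolding \<G>_def compacts_def by auto
  ultimately have "global_attractor (hyperspace X) [?H] \<G>"
    unfolding global_attractor_iff_open_nbhds funpow_hutchinson_singleton
    by (simp add: hutchinson_singleton)
  then show ?thesis unfolding compact_dynamics_def by blast
qed

theorem theorem4:
  fixes X :: "'a metric" and F :: "('a \<Rightarrow> 'a) list"
  assumes "mspace X \<noteq> {}"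
    and "locally_compact_space (mtopology_of X)"
    and "ifs X F"
  shows "(compact_dynamics X F \<longleftrightarrow> compact_dynamics (hyperspace X) [hutchinson F]) \<and>
    (\<forall>G\<^sub>F G\<^sub>H. global_attractor X F G\<^sub>F \<longrightarrow> global_attractor (hyperspace X) [hutchinson F] G\<^sub>H \<longrightarrow>
       G\<^sub>H \<subseteq> compacts (submetric X G\<^sub>F) \<and> G\<^sub>F = (\<Union>A\<in>G\<^sub>H. A))"
proof (intro conjI allI impI)
  show "compact_dynamics X F \<longleftrightarrow> compact_dynamics (hyperspace X) [hutchinson F]"
    using compact_dynamics_hyperspace[OF assms(3)] global_attractor_Union
    unfolding compact_dynamics_def by blast
  fix G\<^sub>F G\<^sub>H
  assume F: "global_attractor X F G\<^sub>F" and H: "global_attractor (hyperspace X) [hutchinson F] G\<^sub>H"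
  have eq: "G\<^sub>F = \<Union>G\<^sub>H"
    using global_attractor_subset[OF F] global_attractor_subset[OF _ F]
      global_attractor_Union[OF H] by blast
  then show "G\<^sub>F = (\<Union>A\<in>G\<^sub>H. A)" by simp
  have "G\<^sub>H \<subseteq> compacts X"
    using H compacts_subset[of G\<^sub>H "hyperspace X"] by (simp add: global_attractor_iff_open_nbhds)
  moreover have "G\<^sub>F \<subseteq> mspace X"
    using F compacts_subset by (auto simp: global_attractor_iff_open_nbhds)
  ultimately show "G\<^sub>H \<subseteq> compacts (submetric X G\<^sub>F)"
    using eq by (auto simp: compacts_submetric)
qed

end
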